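(* Let $\mathcal{G}=\{(G_i,d_i):i\in I\}$ be a metric family of groups. Suppose $\mathcal{G}$ is product-compatible and wreath-compatible. Let $\mathcal{C}$ be the class of $\mathcal{G}$-approximable groups and, for $c>0$, let $\mathcal{C}_c$ be the class of $(\mathcal{G},c)$-approximable groups. Let $\Gamma,\Delta\in\mathcal{C}$, and let $\Gamma\curvearrowright_{\beta}\Delta$ be a sofic $\mathcal{C}_c$-action by automorphisms for some $c>0$. Then $\Delta\rtimes_{\beta}\Gamma\in\mathcal{C}$.
   Context: Metric approximation. A metric family of groups is a family $\mathcal{G}=\{(G_i,d_i):i\in I\}$ where each $G_i$ is a nontrivial group and $d_i$ is a bi-invariant metric on $G_i$, with the diameters of the $(G_i,d_i)$ uniformly bounded. For a group $\Gamma$, a group $G$ with bounded bi-invariant metric $d$, a function $\varphi:\Gamma\to G$, finite $F\subseteq\Gamma$ and $\epsilon,c>0$: $\varphi$ is $(F,\epsilon)$-multiplicative if $d(\varphi(gh),\varphi(g)\varphi(h))<\epsilon$ for all $g,h\in F$ with $gh\in F$; $(F,c)$-separating if $d(\varphi(g),e_G)>c$ for all $e\neq g\in F$; unital if $\varphi(e_\Gamma)=e_G$. $\Gamma$ is $(\mathcal{G},c)$-approximable if for all finite $F\subseteq\Gamma$ and $\epsilon>0$ there are $i\in I$ and a unital, $(F,\epsilon)$-multiplicative, $(F,c)$-separating function $\Gamma\to G_i$. $\Gamma$ is $\mathcal{G}$-approximable if it is $(\mathcal{G},c)$-approximable for some $c>0$. Product-compatible: there exists $\mu>0$ such that for all $i,j\in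 I$ there exist $k=k(i,j)\in I$ and a homomorphism $\Delta_{i,j}:G_i\times G_j\to G_k$ such that (a) for all $\epsilon>0$ there exists $\delta>0$ such that for all $i,j\in I$, $g_i,g_i'\in G_i$, $g_j,g_j'\in G_j$, if $d_i(g_i,g_i')<\delta$ and $d_j(g_j,g_j')<\delta$ then $d_k(\Delta_{i,j}(g_i,g_j),\Delta_{i,j}(g_i',g_j'))<\epsilon$; (b) for all $i,j\in I$, $g_i,g_i'\in G_i$, $g_j,g_j'\in G_j$, $d_k(\Delta_{i,j}(g_i,g_j),\Delta_{i,j}(g_i',g_j'))\geq\mu\max\{d_i(g_i,g_i'),d_j(g_j,g_j')\}$. Wreath-compatible: for all $i\in I$ and $n\in\mathbb{N}$ there exist $j\in I$ and homomorphisms $\tau:G_i^n\to G_j$ and $\psi:\operatorname{Sym}(n)\to G_j$ such that for all $\epsilon>0$ there exists $\delta>0$ such that for all $c>0$, all $g_x,g_x'\in G_i$ ($x\in[n]=\{1,\ldots,n\}$) and all $\sigma_1,\sigma_2\in\operatorname{Sym}(n)$: (a) if there is $X\subseteq[n]$ with $|X|>(1-\delta)n$ and $d_i(g_x,g_x')<\delta$ for all $x\in X$ (respectively $d_i(g_x,g_x')>c$ for all $x\in X$), then $d_j(\tau((g_x)_x),\tau((g_x')_x))<\epsilon$ (respectively $>(1-\epsilon)c$); (b) if $d_n(\sigma_1,\sigma_2)<\delta$, where $d_n$ is the normalized Hamming metric, then $d_j(\psi(\sigma_1),\psi(\sigma_2))<\epsilon$; (c) $\psi(\sigma_1)\tau((g_x)_x)\psi(\sigma_1)^{-1}=\tau((g_{\sigma_1^{-1}\cdot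 x})_x)$. Normalized Hamming metric on $\operatorname{Sym}(A)$, $A$ finite: $d_A(\sigma,\tau)=1-\frac{1}{|A|}|\{a\in A:\sigma(a)=\tau(a)\}|$; write $d_n$ when $A=[n]$. Sofic actions on groups. A partial homomorphism from a subset $E$ of a group to a group $\Lambda$ is a function $\pi$ with $\pi(gh)=\pi(g)\pi(h)$ whenever $g,h,gh\in E$. Given a homomorphism $\alpha:\Gamma\to\operatorname{Aut}(\Delta)$, finite $F\subseteq\Gamma$, $E\subseteq\Delta$, $\epsilon>0$ and a group $\Lambda$, a function $\varphi:\Gamma\to\operatorname{Sym}(A)$ ($A$ finite) is an $(F,E,\epsilon,\Lambda)$-automorphic approximation of $\alpha$ if there exist $S\subseteq A$ with $|S|>(1-\epsilon)|A|$ and injective partial homomorphisms $(\pi_s:E\to\Lambda)_{s\in S}$ such that for all $g\in F$, $h\in E$, $s\in S$, if $\varphi(g)\cdot s\in S$ and $\alpha(g)^{-1}[h]\in E$ then $\pi_{\varphi(g)\cdot s}(h)=\pi_s(\alpha(g)^{-1}[h])$. For a class $\mathcal{D}$ of groups, $\alpha$ is a sofic $\mathcal{D}$-action if for all finite $F\subseteq\Gamma$, $E\subseteq\Delta$ and $\epsilon>0$ there exist $\Lambda\in\mathcal{D}$, a finite set $A$ and a unital $(F,\epsilon)$-multiplicative (with respect to $d_A$) $(F,E,\epsilon,\Lambda)$-automorphic approximation $\varphi:\Gamma\to\operatorname{Sym}(A)$ of $\alpha$.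
   Formalization: In wreath-compatibility, δ is required to depend on ε only, not on i or n; with δ allowed to depend on n the claim fails (e.g. finite groups with discrete metrics, where the approximable groups are the LEF groups). *)

theory Defs
  imports
    "HOL-Analysis.Abstract_Metric_Spaces"
    "HOL-Algebra.Bij"
    "HOL-Algebra.Product_Groups"
begin

section \<open>Metric families and metric approximation\<close>

text \<open>
  All groups of a family live in one carrier type; this is no restriction, since the members of a
  family can be placed inside the disjoint union of their carriers.
\<close>

definition bi_invariant :: "'a monoid \<Rightarrow> ('a \<Rightarrow> 'a \<Rightarrow> real) \<Rightarrow> bool" where
  "bi_invariant G d \<longleftrightarrow>
     (\<forall>x\<in>carrier G. \<forall>y\<in>carrier G. \<forall>z\<in>carrier G.
        d (z \<otimes>\<^bsub>G\<^esub> x) (z \<otimes>\<^bsub>G\<^esub> y) = d x y \<and> d (x \<otimes>\<^bsub>G\<^esub> z) (y \<otimes>\<^bsub>G\<^esub> z) = d x y)"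

definition metric_family ::
    "'i set \<Rightarrow> ('i \<Rightarrow> 'a monoid) \<Rightarrow> ('i \<Rightarrow> 'a \<Rightarrow> 'a \<Rightarrow> real) \<Rightarrow> bool" where
  "metric_family I G d \<longleftrightarrow>
     (\<forall>i\<in>I. group (G i) \<and> carrier (G i) \<noteq> {\<one>\<^bsub>G i\<^esub>} \<and>
        Metric_space (carrier (G i)) (d i) \<and> bi_invariant (G i) (d i)) \<and>
     (\<exists>B. \<forall>i\<in>I. \<forall>x\<in>carrier (G i). \<forall>y\<in>carrier (G i). d i x y \<le> B)"

definition multiplicative ::
    "'g monoid \<Rightarrow> 'a monoid \<Rightarrow> ('a \<Rightarrow> 'a \<Rightarrow> real) \<Rightarrow> 'g set \<Rightarrow> real \<Rightarrow> ('g \<Rightarrow> 'a) \<Rightarrow> bool" where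
  "multiplicative \<Gamma> G d F \<epsilon> \<phi> \<longleftrightarrow>
     (\<forall>g\<in>F. \<forall>h\<in>F. g \<otimes>\<^bsub>\<Gamma>\<^esub> h \<in> F \<longrightarrow> d (\<phi> (g \<otimes>\<^bsub>\<Gamma>\<^esub> h)) (\<phi> g \<otimes>\<^bsub>G\<^esub> \<phi> h) < \<epsilon>)"

definition separating ::
    "'g monoid \<Rightarrow> 'a monoid \<Rightarrow> ('a \<Rightarrow> 'a \<Rightarrow> real) \<Rightarrow> 'g set \<Rightarrow> real \<Rightarrow> ('g \<Rightarrow> 'a) \<Rightarrow> bool" where
  "separating \<Gamma> G d F c \<phi> \<longleftrightarrow> (\<forall>g\<in>F. g \<noteq> \<one>\<^bsub>\<Gamma>\<^esub> \<longrightarrow> d (\<phi> g) \<one>\<^bsub>G\<^esub> > c)"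

definition unital :: "'g monoid \<Rightarrow> 'a monoid \<Rightarrow> ('g \<Rightarrow> 'a) \<Rightarrow> bool" where
  "unital \<Gamma> G \<phi> \<longleftrightarrow> \<phi> \<one>\<^bsub>\<Gamma>\<^esub> = \<one>\<^bsub>G\<^esub>"

definition approximable_with ::
    "'i set \<Rightarrow> ('i \<Rightarrow> 'a monoid) \<Rightarrow> ('i \<Rightarrow> 'a \<Rightarrow> 'a \<Rightarrow> real) \<Rightarrow> real \<Rightarrow> 'g monoid \<Rightarrow> bool" where
  "approximable_with I G d c \<Gamma> \<longleftrightarrow>
     (\<forall>F \<epsilon>. finite F \<and> F \<subseteq> carrier \<Gamma> \<and> \<epsilon> > 0 \<longrightarrow>
        (\<exists>i\<in>I. \<exists>\<phi> \<in> carrier \<Gamma> \<rightarrow> carrier (G i).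
           unital \<Gamma> (G i) \<phi> \<and> multiplicative \<Gamma> (G i) (d i) F \<epsilon> \<phi> \<and>
           separating \<Gamma> (G i) (d i) F c \<phi>))"

definition approximable ::
    "'i set \<Rightarrow> ('i \<Rightarrow> 'a monoid) \<Rightarrow> ('i \<Rightarrow> 'a \<Rightarrow> 'a \<Rightarrow> real) \<Rightarrow> 'g monoid \<Rightarrow> bool" where
  "approximable I G d \<Gamma> \<longleftrightarrow> (\<exists>c>0. approximable_with I G d c \<Gamma>)"

definition approximable_groups_with ::
    "'i set \<Rightarrow> ('i \<Rightarrow> 'a monoid) \<Rightarrow> ('i \<Rightarrow> 'a \<Rightarrow> 'a \<Rightarrow> real) \<Rightarrow> real \<Rightarrow> 'g monoid set" where
  "approximable_groups_with I G d c = {\<Gamma>. group \<Gamma> \<and> approximable_with I G d c \<Gamma>}"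

definition approximable_groups ::
    "'i set \<Rightarrow> ('i \<Rightarrow> 'a monoid) \<Rightarrow> ('i \<Rightarrow> 'a \<Rightarrow> 'a \<Rightarrow> real) \<Rightarrow> 'g monoid set" where
  "approximable_groups I G d = {\<Gamma>. group \<Gamma> \<and> approximable I G d \<Gamma>}"


section \<open>Product- and wreath-compatibility\<close>

definition product_compatible ::
    "'i set \<Rightarrow> ('i \<Rightarrow> 'a monoid) \<Rightarrow> ('i \<Rightarrow> 'a \<Rightarrow> 'a \<Rightarrow> real) \<Rightarrow> bool" where
  "product_compatible I G d \<longleftrightarrow>
     (\<exists>\<mu>>0. \<exists>k D.
        (\<forall>i\<in>I. \<forall>j\<in>I. k i j \<in> I \<and> D i j \<in> hom (G i \<times>\<times> G j) (G (k i j))) \<and>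
        (\<forall>\<epsilon>>0. \<exists>\<delta>>0. \<forall>i\<in>I. \<forall>j\<in>I.
           \<forall>x\<in>carrier (G i). \<forall>x'\<in>carrier (G i). \<forall>y\<in>carrier (G j). \<forall>y'\<in>carrier (G j).
             d i x x' < \<delta> \<and> d j y y' < \<delta> \<longrightarrow>
             d (k i j) (D i j (x, y)) (D i j (x', y')) < \<epsilon>) \<and>
        (\<forall>i\<in>I. \<forall>j\<in>I.
           \<forall>x\<in>carrier (G i). \<forall>x'\<in>carrier (G i). \<forall>y\<in>carrier (G j). \<forall>y'\<in>carrier (G j).
             d (k i j) (D i j (x, y)) (D i j (x', y')) \<ge> \<mu> * max (d i x x') (d j y y')))"

definition hamming :: "'b set \<Rightarrow> ('b \<Rightarrow> 'b) \<Rightarrow> ('b \<Rightarrow> 'b) \<Rightarrow> real" where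
  "hamming A \<sigma> \<tau> = 1 - real (card {a\<in>A. \<sigma> a = \<tau> a}) / real (card A)"

text \<open>
  \<open>Sym(A)\<close> is \<open>BijGroup A\<close>, and \<open>G\<^sub>i\<^sup>n\<close> is the product of copies of \<open>G\<^sub>i\<close> indexed by \<open>{1..n}\<close>.
  As in product-compatibility, \<open>\<delta>\<close> depends on \<open>\<epsilon>\<close> only. If it could depend on \<open>n\<close>, then
  \<open>\<delta> < 1 / n\<close> would force \<open>X = {1..n}\<close> in (a) and \<open>\<sigma>\<^sub>1 = \<sigma>\<^sub>2\<close> in (b). The case \<open>n = 0\<close> holds
  trivially.
\<close>

definition wreath_compatible ::
    "'i set \<Rightarrow> ('i \<Rightarrow> 'a monoid) \<Rightarrow> ('i \<Rightarrow> 'a \<Rightarrow> 'a \<Rightarrow> real) \<Rightarrow> bool" where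
  "wreath_compatible I G d \<longleftrightarrow>
     (\<exists>(j :: 'i \<Rightarrow> nat \<Rightarrow> 'i) \<tau> \<psi>.
        (\<forall>i\<in>I. \<forall>n. j i n \<in> I \<and>
           \<tau> i n \<in> hom (product_group {1..n} (\<lambda>_. G i)) (G (j i n)) \<and>
           \<psi> i n \<in> hom (BijGroup {1..n}) (G (j i n))) \<and>
        (\<forall>\<epsilon>>0. \<exists>\<delta>>0. \<forall>i\<in>I. \<forall>n. \<forall>c>0.
           \<forall>g \<in> carrier (product_group {1..n} (\<lambda>_. G i)).
           \<forall>g' \<in> carrier (product_group {1..n} (\<lambda>_. G i)).
           \<forall>\<sigma>\<^sub>1 \<in> carrier (BijGroup {1..n}). \<forall>\<sigma>\<^sub>2 \<in> carrier (BijGroup {1..n}).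
             (\<forall>X \<subseteq> {1..n}. real (card X) > (1 - \<delta>) * real n \<longrightarrow>
                ((\<forall>x\<in>X. d i (g x) (g' x) < \<delta>) \<longrightarrow> d (j i n) (\<tau> i n g) (\<tau> i n g') < \<epsilon>) \<and>
                ((\<forall>x\<in>X. d i (g x) (g' x) > c) \<longrightarrow> d (j i n) (\<tau> i n g) (\<tau> i n g') > (1 - \<epsilon>) * c)) \<and>
             (hamming {1..n} \<sigma>\<^sub>1 \<sigma>\<^sub>2 < \<delta> \<longrightarrow> d (j i n) (\<psi> i n \<sigma>\<^sub>1) (\<psi> i n \<sigma>\<^sub>2) < \<epsilon>) \<and>
             \<psi> i n \<sigma>\<^sub>1 \<otimes>\<^bsub>G (j i n)\<^esub> \<tau> i n g \<otimes>\<^bsub>G (j i n)\<^esub> inv\<^bsub>G (j i n)\<^esub> \<psi> i n \<sigma>\<^sub>1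
               = \<tau> i n (\<lambda>x\<in>{1..n}. g ((inv\<^bsub>BijGroup {1..n}\<^esub> \<sigma>\<^sub>1) x))))"


section \<open>Sofic actions on groups\<close>

definition partial_hom :: "'d monoid \<Rightarrow> 'd set \<Rightarrow> 'l monoid \<Rightarrow> ('d \<Rightarrow> 'l) \<Rightarrow> bool" where
  "partial_hom \<Delta> E \<Lambda> \<pi> \<longleftrightarrow>
     \<pi> \<in> E \<rightarrow> carrier \<Lambda> \<and>
     (\<forall>g\<in>E. \<forall>h\<in>E. g \<otimes>\<^bsub>\<Delta>\<^esub> h \<in> E \<longrightarrow> \<pi> (g \<otimes>\<^bsub>\<Delta>\<^esub> h) = \<pi> g \<otimes>\<^bsub>\<Lambda>\<^esub> \<pi> h)"

definition automorphic_approximation ::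
    "'d monoid \<Rightarrow> ('g \<Rightarrow> 'd \<Rightarrow> 'd) \<Rightarrow> 'g set \<Rightarrow> 'd set \<Rightarrow> real \<Rightarrow> 'l monoid \<Rightarrow>
     'b set \<Rightarrow> ('g \<Rightarrow> 'b \<Rightarrow> 'b) \<Rightarrow> bool" where
  "automorphic_approximation \<Delta> \<alpha> F E \<epsilon> \<Lambda> A \<phi> \<longleftrightarrow>
     (\<exists>S \<subseteq> A. real (card S) > (1 - \<epsilon>) * real (card A) \<and>
        (\<exists>\<pi>. (\<forall>s\<in>S. partial_hom \<Delta> E \<Lambda> (\<pi> s) \<and> inj_on (\<pi> s) E) \<and>
           (\<forall>g\<in>F. \<forall>h\<in>E. \<forall>s\<in>S. \<phi> g s \<in> S \<and> (inv\<^bsub>AutoGroup \<Delta>\<^esub> (\<alpha> g)) h \<in> E \<longrightarrow>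
              \<pi> (\<phi> g s) h = \<pi> s ((inv\<^bsub>AutoGroup \<Delta>\<^esub> (\<alpha> g)) h))))"

text \<open>
  The finite sets \<open>A\<close> are taken among finite sets of natural numbers, which represent every finite
  set up to bijection. The class \<open>\<D>\<close> consists of groups over an arbitrary type \<open>'l\<close>; a single type
  can accommodate the groups \<open>\<Lambda>\<close> for all triples \<open>(F, E, \<epsilon>)\<close>.
\<close>

definition sofic_action ::
    "'l monoid set \<Rightarrow> 'g monoid \<Rightarrow> 'd monoid \<Rightarrow> ('g \<Rightarrow> 'd \<Rightarrow> 'd) \<Rightarrow> bool" where
  "sofic_action \<D> \<Gamma> \<Delta> \<alpha> \<longleftrightarrow>
     \<alpha> \<in> hom \<Gamma> (AutoGroup \<Delta>) \<and>
     (\<forall>F E \<epsilon>. finite F \<and> F \<subseteq> carrier \<Gamma> \<and> finite E \<and> E \<subseteq> carrier \<Delta> \<and> \<epsilon> > 0 \<longrightarrow>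
        (\<exists>\<Lambda>\<in>\<D>. \<exists>A :: nat set. finite A \<and>
           (\<exists>\<phi> \<in> carrier \<Gamma> \<rightarrow> carrier (BijGroup A).
              unital \<Gamma> (BijGroup A) \<phi> \<and>
              multiplicative \<Gamma> (BijGroup A) (hamming A) F \<epsilon> \<phi> \<and>
              automorphic_approximation \<Delta> \<alpha> F E \<epsilon> \<Lambda> A \<phi>)))"

definition semidirect_product ::
    "'d monoid \<Rightarrow> 'g monoid \<Rightarrow> ('g \<Rightarrow> 'd \<Rightarrow> 'd) \<Rightarrow> ('d \<times> 'g) monoid" where
  "semidirect_product \<Delta> \<Gamma> \<beta> =
     \<lparr>carrier = carrier \<Delta> \<times> carrier \<Gamma>,
      monoid.mult = (\<lambda>(h, g) (h', g'). (h \<otimes>\<^bsub>\<Delta>\<^esub> \<beta> g h', g \<otimes>\<^bsub>\<Gamma>\<^esub> g')),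
      one = (\<one>\<^bsub>\<Delta>\<^esub>, \<one>\<^bsub>\<Gamma>\<^esub>)\<rparr>"

end

theory Submission
  imports Defs
begin

text \<open>
  Permute the coordinates of \<open>\<Lambda>\<^sup>n\<close> by the sofic approximation \<open>\<phi>\<close> of \<open>\<Gamma>\<close>, embed \<open>\<Delta>\<close> into
  almost all coordinates by the maps \<open>\<pi>\<^sub>s\<close>, and follow by an approximation \<open>\<theta>\<close> of \<open>\<Lambda>\<close> in a
  member of the family. Wreath-compatibility turns this into the almost multiplicative map
  \<open>(h, g) \<mapsto> \<tau> ((\<theta> (\<pi>\<^sub>s h))\<^sub>s) \<psi> (\<phi> g)\<close>, which separates the elements of \<open>\<Delta>\<close> from the identity.
  The elements outside \<open>\<Delta>\<close> are separated by an approximation of \<open>\<Gamma>\<close>, and product-compatibility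
  joins the two maps.
\<close>

section \<open>Bi-invariant metrics, automorphism groups and semidirect products\<close>

text \<open>Triangle inequality through \<open>x' \<otimes> y\<close>: right invariance cancels
  \<open>y\<close> in the first distance and left invariance cancels \<open>x'\<close> in the
  second. Errors made in two factors therefore add up.\<close>

lemma bi_invariant_mult_le:
  assumes "group H" "Metric_space (carrier H) d" "bi_invariant H d"
    and x: "x \<in> carrier H" and x': "x' \<in> carrier H"
    and y: "y \<in> carrier H" and y': "y' \<in> carrier H"
  shows "d (x \<otimes>\<^bsub>H\<^esub> y) (x' \<otimes>\<^bsub>H\<^esub> y') \<le> d x x' + d y y'"
proof -
  interpret H: group H by fact
  interpret Metric_space "carrier H" d by fact
  have "d (x \<otimes>\<^bsub>H\<^esub> y) (x' \<otimes>\<^bsub>H\<^esub> y') \<le> d (x \<otimes>\<^bsub>H\<^esub> y) (x' \<otimes>\<^bsub>H\<^esub> y) + d (x' \<otimes>\<^bsub>H\<^esub> y) (x' \<otimes>\<^bsub>H\<^esub> y')"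
    using x x' y y' by (intro triangle) auto
  also have "d (x \<otimes>\<^bsub>H\<^esub> y) (x' \<otimes>\<^bsub>H\<^esub> y) = d x x'"
    using assms(3) x x' y by (simp add: bi_invariant_def)
  also have "d (x' \<otimes>\<^bsub>H\<^esub> y) (x' \<otimes>\<^bsub>H\<^esub> y') = d y y'"
    using assms(3) y y' x' by (simp add: bi_invariant_def)
  finally show ?thesis .
qed

lemma carrier_BijGroup: "carrier (BijGroup S) = Bij S"
  by (simp add: BijGroup_def)

text \<open>The equivariance condition of an automorphic approximation evaluates the abstract
  inverse in \<open>AutoGroup \<Delta>\<close>. The law \<open>l_inv\<close>, read pointwise at
  \<open>h\<close>, identifies it with the inverse function.\<close>

lemma AutoGroup_inv_apply:
  assumes "group \<Delta>" "a \<in> carrier (AutoGroup \<Delta>)" "h \<in> carrier \<Delta>"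
  shows "(inv\<^bsub>AutoGroup \<Delta>\<^esub> a) (a h) = h"
proof -
  interpret \<Delta>: group \<Delta> by fact
  interpret A: group "AutoGroup \<Delta>" by (rule \<Delta>.AutoGroup)
  have 1: "a \<in> auto \<Delta>" "inv\<^bsub>AutoGroup \<Delta>\<^esub> a \<in> auto \<Delta>"
    using assms(2) A.inv_closed[OF assms(2)] by (simp_all add: AutoGroup_def)
  have "compose (carrier \<Delta>) (inv\<^bsub>AutoGroup \<Delta>\<^esub> a) a = (\<lambda>x\<in>carrier \<Delta>. x)"
    using A.l_inv[OF assms(2)] 1 by (simp add: AutoGroup_def BijGroup_def auto_def)
  from fun_cong[OF this, of h] show ?thesis
    using assms(3) by (simp add: compose_def)
qed

lemma hom_AutoGroupD:
  assumes "\<beta> \<in> hom \<Gamma> (AutoGroup \<Delta>)"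
  shows "g \<in> carrier \<Gamma> \<Longrightarrow> \<beta> g \<in> hom \<Delta> \<Delta>"
    and "g \<in> carrier \<Gamma> \<Longrightarrow> h \<in> carrier \<Delta> \<Longrightarrow> \<beta> g h \<in> carrier \<Delta>"
    and "\<lbrakk>g \<in> carrier \<Gamma>; g' \<in> carrier \<Gamma>; h \<in> carrier \<Delta>\<rbrakk> \<Longrightarrow> \<beta> (g \<otimes>\<^bsub>\<Gamma>\<^esub> g') h = \<beta> g (\<beta> g' h)"
proof -
  have *: "\<beta> g \<in> hom \<Delta> \<Delta> \<and> \<beta> g \<in> Bij (carrier \<Delta>)" if "g \<in> carrier \<Gamma>" for g
    using hom_in_carrier[OF assms that] by (simp add: AutoGroup_def auto_def)
  show "g \<in> carrier \<Gamma> \<Longrightarrow> \<beta> g \<in> hom \<Delta> \<Delta>"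
    using * by blast
  show "g \<in> carrier \<Gamma> \<Longrightarrow> h \<in> carrier \<Delta> \<Longrightarrow> \<beta> g h \<in> carrier \<Delta>"
    using * hom_in_carrier by metis
  show "\<beta> (g \<otimes>\<^bsub>\<Gamma>\<^esub> g') h = \<beta> g (\<beta> g' h)"
    if "g \<in> carrier \<Gamma>" "g' \<in> carrier \<Gamma>" "h \<in> carrier \<Delta>"
    using hom_mult[OF assms that(1,2)] * that
    by (simp add: AutoGroup_def BijGroup_def compose_def)
qed

text \<open>Membership in \<open>approximable_groups\<close> includes being a group. Associativity
  combines the action law for \<open>\<beta>\<close> with multiplicativity of each
  \<open>\<beta> g\<close>.\<close>

lemma group_semidirect_product:
  assumes "group \<Gamma>" "group \<Delta>" and \<beta>: "\<beta> \<in> hom \<Gamma> (AutoGroup \<Delta>)"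
  shows "group (semidirect_product \<Delta> \<Gamma> \<beta>)"
proof -
  interpret \<Gamma>: group \<Gamma> by fact
  interpret \<Delta>: group \<Delta> by fact
  interpret A: group "AutoGroup \<Delta>" by (rule \<Delta>.AutoGroup)
  note D = hom_AutoGroupD[OF \<beta>]
  have one: "\<beta> \<one>\<^bsub>\<Gamma>\<^esub> h = h" if "h \<in> carrier \<Delta>" for h
    using hom_one[OF \<beta> \<Gamma>.group_axioms A.group_axioms] that
    by (simp add: AutoGroup_def BijGroup_def)
  have inv: "\<beta> g (\<beta> (inv\<^bsub>\<Gamma>\<^esub> g) h) = h" "\<beta> (inv\<^bsub>\<Gamma>\<^esub> g) (\<beta> g h) = h"
    if "g \<in> carrier \<Gamma>" "h \<in> carrier \<Delta>" for g h
    using that D(3)[of g "inv\<^bsub>\<Gamma>\<^esub> g" h] D(3)[of "inv\<^bsub>\<Gamma>\<^esub> g" g h] one by auto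
  note m = hom_mult[OF D(1)]
  have one': "\<beta> g \<one>\<^bsub>\<Delta>\<^esub> = \<one>\<^bsub>\<Delta>\<^esub>" if "g \<in> carrier \<Gamma>" for g
    using hom_one[OF D(1)[OF that] \<Delta>.group_axioms \<Delta>.group_axioms] .
  show ?thesis
  proof (rule groupI)
    fix x assume "x \<in> carrier (semidirect_product \<Delta> \<Gamma> \<beta>)"
    then obtain h g where x: "x = (h, g)" "h \<in> carrier \<Delta>" "g \<in> carrier \<Gamma>"
      by (auto simp: semidirect_product_def)
    \<comment> \<open>\<open>groupI\<close> asks for a left inverse. The second coordinate must be
      the inverse of \<open>g\<close>, and it twists \<open>h\<close>, so the inverse of
      \<open>h\<close> has to be twisted in the same way.\<close>
    let ?y = "(\<beta> (inv\<^bsub>\<Gamma>\<^esub> g) (inv\<^bsub>\<Delta>\<^esub> h), inv\<^bsub>\<Gamma>\<^esub> g)"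
    have "\<beta> (inv\<^bsub>\<Gamma>\<^esub> g) (inv\<^bsub>\<Delta>\<^esub> h) \<otimes>\<^bsub>\<Delta>\<^esub> \<beta> (inv\<^bsub>\<Gamma>\<^esub> g) h = \<one>\<^bsub>\<Delta>\<^esub>"
      using m[of "inv\<^bsub>\<Gamma>\<^esub> g" "inv\<^bsub>\<Delta>\<^esub> h" h] x one' by simp
    then show "\<exists>y\<in>carrier (semidirect_product \<Delta> \<Gamma> \<beta>).
        y \<otimes>\<^bsub>semidirect_product \<Delta> \<Gamma> \<beta>\<^esub> x = \<one>\<^bsub>semidirect_product \<Delta> \<Gamma> \<beta>\<^esub>"
      using x D(2) by (intro bexI[of _ ?y]) (auto simp: semidirect_product_def)
  qed (auto simp: semidirect_product_def D one m \<Delta>.m_assoc \<Gamma>.m_assoc)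
qed

section \<open>Transport of sofic approximations along a bijection of the underlying finite
  sets\<close>

text \<open>This is conjugation of \<open>\<sigma>\<close> by \<open>f\<close>. The restriction to
  \<open>B\<close> is there because \<open>Bij B\<close> consists of extensional functions.\<close>

definition conjugate_perm :: "'a set \<Rightarrow> ('a \<Rightarrow> 'b) \<Rightarrow> ('b \<Rightarrow> 'b) \<Rightarrow> 'a \<Rightarrow> 'a" where
  "conjugate_perm B f \<sigma> = (\<lambda>x\<in>B. inv_into B f (\<sigma> (f x)))"

lemma conjugate_perm_Bij:
  assumes "bij_betw f B A" "\<sigma> \<in> Bij A"
  shows "conjugate_perm B f \<sigma> \<in> Bij B"
proof -
  have "bij_betw (inv_into B f \<circ> \<sigma> \<circ> f) B B"
    using assms by (auto simp: Bij_def intro!: bij_betw_trans bij_betw_inv_into)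
  then have "bij_betw (conjugate_perm B f \<sigma>) B B"
    by (rule bij_betw_cong[THEN iffD1, rotated]) (simp add: conjugate_perm_def)
  then show ?thesis
    by (simp add: Bij_def conjugate_perm_def)
qed

text \<open>The inner \<open>f\<close> and \<open>inv_into B f\<close> cancel because
  \<open>\<tau> (f x)\<close> lies in \<open>A\<close>. Outside \<open>B\<close> both sides are
  \<open>undefined\<close>, so the functions are equal everywhere.\<close>

lemma conjugate_perm_mult:
  assumes "bij_betw f B A" "\<sigma> \<in> Bij A" "\<tau> \<in> Bij A"
  shows "conjugate_perm B f (\<sigma> \<otimes>\<^bsub>BijGroup A\<^esub> \<tau>)
       = conjugate_perm B f \<sigma> \<otimes>\<^bsub>BijGroup B\<^esub> conjugate_perm B f \<tau>"
proof
  fix x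
  have "\<tau> (f x) \<in> A" "f x \<in> A" if "x \<in> B"
    using that assms by (auto dest: Bij_imp_funcset bij_betwE)
  then show "conjugate_perm B f (\<sigma> \<otimes>\<^bsub>BijGroup A\<^esub> \<tau>) x
      = (conjugate_perm B f \<sigma> \<otimes>\<^bsub>BijGroup B\<^esub> conjugate_perm B f \<tau>) x"
    using assms conjugate_perm_Bij[OF assms(1)] bij_betw_inv_into_right[OF assms(1)]
      bij_betwE[OF bij_betw_inv_into[OF assms(1)]]
    by (auto simp: BijGroup_def compose_def conjugate_perm_def)
qed

text \<open>The bijection \<open>f\<close> maps the set where the conjugates agree onto the set
  where \<open>\<sigma>\<close> and \<open>\<tau>\<close> agree, and \<open>A\<close> and
  \<open>B\<close> have the same cardinality.\<close>

lemma hamming_conjugate_perm: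
  assumes f: "bij_betw f B A" and "\<sigma> \<in> Bij A" "\<tau> \<in> Bij A"
  shows "hamming B (conjugate_perm B f \<sigma>) (conjugate_perm B f \<tau>) = hamming A \<sigma> \<tau>"
proof -
  have [simp]: "inv_into B f (\<sigma> (f x)) = inv_into B f (\<tau> (f x)) \<longleftrightarrow> \<sigma> (f x) = \<tau> (f x)"
    if "x \<in> B" for x
  proof -
    have "\<sigma> (f x) \<in> A" "\<tau> (f x) \<in> A"
      using that assms by (auto dest!: Bij_imp_funcset bij_betwE)
    then show ?thesis
      using inj_on_eq_iff[OF bij_betw_imp_inj_on[OF bij_betw_inv_into[OF f]]] by blast
  qed
  have "f ` {x \<in> B. \<sigma> (f x) = \<tau> (f x)} = {a \<in> A. \<sigma> a = \<tau> a}"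
    using f by (auto simp: bij_betw_def)
  then have "card {a \<in> A. \<sigma> a = \<tau> a} = card {x \<in> B. \<sigma> (f x) = \<tau> (f x)}"
    using f by (metis (no_types, lifting) bij_betw_def card_image inj_on_subset mem_Collect_eq subsetI)
  moreover have "{x \<in> B. conjugate_perm B f \<sigma> x = conjugate_perm B f \<tau> x}
      = {x \<in> B. \<sigma> (f x) = \<tau> (f x)}"
    by (auto simp: conjugate_perm_def)
  ultimately show ?thesis
    using bij_betw_same_card[OF f] by (simp add: hamming_def)
qed

text \<open>Pull the good set \<open>S\<close> back along \<open>f\<close> and reindex the partial
  homomorphisms as \<open>\<pi> (f x)\<close>; the group \<open>\<Lambda>\<close> and the set
  \<open>E\<close> stay the same.\<close>

lemma automorphic_approximation_conjugate_perm:
  assumes f: "bij_betw f B A"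
    and Bij: "\<And>g. g \<in> F \<Longrightarrow> \<phi> g \<in> Bij A"
    and appr: "automorphic_approximation \<Delta> \<alpha> F E \<epsilon> \<Lambda> A \<phi>"
  shows "automorphic_approximation \<Delta> \<alpha> F E \<epsilon> \<Lambda> B (\<lambda>g. conjugate_perm B f (\<phi> g))"
proof -
  from appr obtain S \<pi> where S: "S \<subseteq> A" "real (card S) > (1 - \<epsilon>) * real (card A)"
    and \<pi>: "\<And>s. s \<in> S \<Longrightarrow> partial_hom \<Delta> E \<Lambda> (\<pi> s) \<and> inj_on (\<pi> s) E"
    and eq: "\<And>g h s. \<lbrakk>g \<in> F; h \<in> E; s \<in> S; \<phi> g s \<in> S; (inv\<^bsub>AutoGroup \<Delta>\<^esub> (\<alpha> g)) h \<in> E\<rbrakk>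
        \<Longrightarrow> \<pi> (\<phi> g s) h = \<pi> s ((inv\<^bsub>AutoGroup \<Delta>\<^esub> (\<alpha> g)) h)"
    unfolding automorphic_approximation_def by blast
  define S' where "S' = inv_into B f ` S"
  have inv: "bij_betw (inv_into B f) A B"
    using f by (rule bij_betw_inv_into)
  have "card S' = card S"
    unfolding S'_def using inv S(1) by (meson bij_betw_def card_image inj_on_subset)
  moreover have S'B: "S' \<subseteq> B"
    using S(1) inv by (auto simp: S'_def bij_betw_def)
  moreover have fS: "f s \<in> S" if "s \<in> S'" for s
    using that S(1) bij_betw_inv_into_right[OF f] by (auto simp: S'_def)
  \<comment> \<open>\<open>f\<close> intertwines the two permutations, so equivariance at
    \<open>s\<close> is the given equivariance at \<open>f s\<close>.\<close>
  moreover have "f (conjugate_perm B f (\<phi> g) s) = \<phi> g (f s)" if "g \<in> F" "s \<in> S'" for g s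
  proof -
    have "\<phi> g (f s) \<in> A"
      using Bij_imp_funcset[OF Bij[OF that(1)]] fS[OF that(2)] S(1) by auto
    then show ?thesis
      using bij_betw_inv_into_right[OF f] that S'B by (auto simp: conjugate_perm_def)
  qed
  ultimately show ?thesis
    unfolding automorphic_approximation_def
    using S(2) \<pi> eq bij_betw_same_card[OF f]
    by (intro exI[of _ S'] conjI exI[of _ "\<lambda>x. \<pi> (f x)"]) (auto, metis)
qed

text \<open>A sofic action supplies some finite set \<open>A\<close>, whereas wreath-compatibility
  speaks of permutations of \<open>{1..n}\<close>. Conjugating by an enumeration of \<open>A\<close>
  bridges the two, with \<open>n = card A\<close>.\<close>

lemma sofic_action_interval:
  assumes "sofic_action \<D> \<Gamma> \<Delta> \<alpha>" "finite F" "F \<subseteq> carrier \<Gamma>" "finite E" "E \<subseteq> carrier \<Delta>" "\<epsilon> > 0"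
  obtains \<Lambda> n \<phi> where "\<Lambda> \<in> \<D>" "\<phi> \<in> carrier \<Gamma> \<rightarrow> Bij {1..n::nat}"
    "unital \<Gamma> (BijGroup {1..n}) \<phi>"
    "multiplicative \<Gamma> (BijGroup {1..n}) (hamming {1..n}) F \<epsilon> \<phi>"
    "automorphic_approximation \<Delta> \<alpha> F E \<epsilon> \<Lambda> {1..n} \<phi>"
proof -
  obtain \<Lambda> and A :: "nat set" and \<phi> where "\<Lambda> \<in> \<D>" and A: "finite A"
    and \<phi>: "\<phi> \<in> carrier \<Gamma> \<rightarrow> Bij A" "unital \<Gamma> (BijGroup A) \<phi>"
      "multiplicative \<Gamma> (BijGroup A) (hamming A) F \<epsilon> \<phi>"
    and appr: "automorphic_approximation \<Delta> \<alpha> F E \<epsilon> \<Lambda> A \<phi>"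
    using assms unfolding sofic_action_def carrier_BijGroup by meson
  from ex_bij_betw_nat_finite_1[OF A] obtain f where f: "bij_betw f {1..card A} A" ..
  let ?n = "card A" and ?\<phi> = "\<lambda>g. conjugate_perm {1..card A} f (\<phi> g)"
  show thesis
  proof (rule that[of \<Lambda> ?\<phi> ?n])
    show "\<Lambda> \<in> \<D>" by fact
    show "?\<phi> \<in> carrier \<Gamma> \<rightarrow> Bij {1..?n}"
      using conjugate_perm_Bij[OF f] \<phi>(1) by auto
    have "f x \<in> A" "inv_into {1..?n} f (f x) = x" if "x \<in> {1..?n}" for x
      using that f bij_betw_inv_into_left bij_betwE by metis+
    then show "unital \<Gamma> (BijGroup {1..?n}) ?\<phi>"
      using \<phi>(2) unfolding unital_def BijGroup_def conjugate_perm_def by force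
    show "multiplicative \<Gamma> (BijGroup {1..?n}) (hamming {1..?n}) F \<epsilon> ?\<phi>"
      unfolding multiplicative_def
    proof (intro ballI impI)
      fix g h assume gh: "g \<in> F" "h \<in> F" "g \<otimes>\<^bsub>\<Gamma>\<^esub> h \<in> F"
      then have B: "\<phi> g \<in> Bij A" "\<phi> h \<in> Bij A" "\<phi> (g \<otimes>\<^bsub>\<Gamma>\<^esub> h) \<in> Bij A"
        using \<phi>(1) assms(3) by auto
      moreover have "\<phi> g \<otimes>\<^bsub>BijGroup A\<^esub> \<phi> h \<in> Bij A"
        using B by (simp add: BijGroup_def compose_Bij)
      moreover have "hamming A (\<phi> (g \<otimes>\<^bsub>\<Gamma>\<^esub> h)) (\<phi> g \<otimes>\<^bsub>BijGroup A\<^esub> \<phi> h) < \<epsilon>"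
        using \<phi>(3) gh by (auto simp: multiplicative_def)
      ultimately show "hamming {1..?n} (?\<phi> (g \<otimes>\<^bsub>\<Gamma>\<^esub> h)) (?\<phi> g \<otimes>\<^bsub>BijGroup {1..?n}\<^esub> ?\<phi> h) < \<epsilon>"
        by (simp only: hamming_conjugate_perm[OF f] conjugate_perm_mult[OF f, symmetric])
    qed
    show "automorphic_approximation \<Delta> \<alpha> F E \<epsilon> \<Lambda> {1..?n} ?\<phi>"
      using automorphic_approximation_conjugate_perm[OF f _ appr] \<phi>(1) assms(3) by auto
  qed
qed

section \<open>The almost multiplicative map obtained from wreath-compatibility\<close>

text \<open>Keeps the simplifier from turning the index set \<open>{1..n}\<close> into
  \<open>{Suc 0..n}\<close>, which would no longer match the assumptions.\<close>

declare One_nat_def [simp del]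

lemma approximable_withE:
  assumes "approximable_with I G d c \<Gamma>" "finite F" "F \<subseteq> carrier \<Gamma>" "\<epsilon> > 0"
  obtains i \<phi> where "i \<in> I" "\<phi> \<in> carrier \<Gamma> \<rightarrow> carrier (G i)" "unital \<Gamma> (G i) \<phi>"
    "multiplicative \<Gamma> (G i) (d i) F \<epsilon> \<phi>" "separating \<Gamma> (G i) (d i) F c \<phi>"
proof -
  have "\<exists>i\<in>I. \<exists>\<phi>\<in>carrier \<Gamma> \<rightarrow> carrier (G i). unital \<Gamma> (G i) \<phi> \<and>
      multiplicative \<Gamma> (G i) (d i) F \<epsilon> \<phi> \<and> separating \<Gamma> (G i) (d i) F c \<phi>"
    using assms by (simp add: approximable_with_def)
  then show thesis
    by (elim bexE conjE) (rule that)
qed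

text \<open>Inclusion-exclusion for two sets of equal size inside \<open>{1..n}\<close>: the loss at
  most doubles. A point of the intersection is \<open>\<sigma> s\<close> with \<open>s\<close> and
  \<open>\<sigma> s\<close> both in \<open>S\<close>, as the equivariance of the maps
  \<open>\<pi>\<close> requires.\<close>

lemma card_Int_perm_image:
  assumes S: "S \<subseteq> {1..n}" and \<sigma>: "\<sigma> \<in> Bij {1..n}"
    and large: "real (card S) > (1 - \<delta> / 2) * real n"
  shows "real (card (S \<inter> \<sigma> ` S)) > (1 - \<delta>) * real n"
proof -
  have fin: "finite S"
    using S finite_subset by blast
  have "bij_betw \<sigma> {1..n} {1..n}"
    using \<sigma> by (simp add: Bij_def)
  then have "inj_on \<sigma> S" "\<sigma> ` S \<subseteq> {1..n}"
    using S by (meson bij_betw_def inj_on_subset, metis bij_betw_imp_surj_on image_mono)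
  then have "card (\<sigma> ` S) = card S" "card (S \<union> \<sigma> ` S) \<le> n"
    using S card_image card_mono[of "{1..n}" "S \<union> \<sigma> ` S"] by auto
  then have "2 * card S \<le> n + card (S \<inter> \<sigma> ` S)"
    using card_Un_Int[OF fin, of "\<sigma> ` S"] fin by auto
  then have "2 * real (card S) \<le> real n + real (card (S \<inter> \<sigma> ` S))"
    by linarith
  then show ?thesis
    using large by (simp add: algebra_simps)
qed

text \<open>Conjugation by \<open>\<psi> (\<phi> g)\<close> permutes coordinates, and on most of
  them equivariance of the maps \<open>\<pi>\<close> identifies this permutation with the action of
  \<open>\<beta> g\<close>. The bound \<open>c / 2\<close> depends on neither \<open>F\<close> nor
  \<open>\<epsilon>\<close>, as approximability with one constant demands.\<close>

lemma sofic_action_wreath_approximation: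
  fixes G :: "'i \<Rightarrow> 'a monoid" and \<Gamma> :: "'g monoid" and \<Delta> :: "'d monoid"
  assumes fam: "metric_family I G d" and wreath: "wreath_compatible I G d"
    and \<Gamma>: "group \<Gamma>" and \<Delta>: "group \<Delta>" and c: "c > 0"
    and sofic: "sofic_action (approximable_groups_with I G d c :: 'l monoid set) \<Gamma> \<Delta> \<beta>"
    and F: "finite F" "F \<subseteq> carrier (semidirect_product \<Delta> \<Gamma> \<beta>)" and \<epsilon>: "\<epsilon> > 0"
  obtains k \<Theta> where "k \<in> I" "\<Theta> \<in> carrier (semidirect_product \<Delta> \<Gamma> \<beta>) \<rightarrow> carrier (G k)"
    "unital (semidirect_product \<Delta> \<Gamma> \<beta>) (G k) \<Theta>"
    "multiplicative (semidirect_product \<Delta> \<Gamma> \<beta>) (G k) (d k) F \<epsilon> \<Theta>"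
    "\<forall>h. (h, \<one>\<^bsub>\<Gamma>\<^esub>) \<in> F \<longrightarrow> h \<noteq> \<one>\<^bsub>\<Delta>\<^esub> \<longrightarrow> d k (\<Theta> (h, \<one>\<^bsub>\<Gamma>\<^esub>)) \<one>\<^bsub>G k\<^esub> > c / 2"
proof -
  interpret \<Gamma>: group \<Gamma> by fact
  interpret \<Delta>: group \<Delta> by fact
  have \<beta>: "\<beta> \<in> hom \<Gamma> (AutoGroup \<Delta>)"
    using sofic by (simp add: sofic_action_def)
  note \<beta>D = hom_AutoGroupD[OF \<beta>]

  obtain j :: "'i \<Rightarrow> nat \<Rightarrow> 'i" and \<tau> \<psi> where
    j: "\<And>i n. i \<in> I \<Longrightarrow> j i n \<in> I"
    and \<tau>: "\<And>i n. i \<in> I \<Longrightarrow> \<tau> i n \<in> hom (product_group {1..n} (\<lambda>_. G i)) (G (j i n))"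
    and \<psi>: "\<And>i n. i \<in> I \<Longrightarrow> \<psi> i n \<in> hom (BijGroup {1..n}) (G (j i n))"
    and W: "\<forall>\<epsilon>>0. \<exists>\<delta>>0. \<forall>i\<in>I. \<forall>n. \<forall>c>0.
           \<forall>g \<in> carrier (product_group {1..n} (\<lambda>_. G i)).
           \<forall>g' \<in> carrier (product_group {1..n} (\<lambda>_. G i)).
           \<forall>\<sigma>\<^sub>1 \<in> carrier (BijGroup {1..n}). \<forall>\<sigma>\<^sub>2 \<in> carrier (BijGroup {1..n}).
             (\<forall>X \<subseteq> {1..n}. real (card X) > (1 - \<delta>) * real n \<longrightarrow>
                ((\<forall>x\<in>X. d i (g x) (g' x) < \<delta>) \<longrightarrow> d (j i n) (\<tau> i n g) (\<tau> i n g') < \<epsilon>) \<and>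
                ((\<forall>x\<in>X. d i (g x) (g' x) > c) \<longrightarrow> d (j i n) (\<tau> i n g) (\<tau> i n g') > (1 - \<epsilon>) * c)) \<and>
             (hamming {1..n} \<sigma>\<^sub>1 \<sigma>\<^sub>2 < \<delta> \<longrightarrow> d (j i n) (\<psi> i n \<sigma>\<^sub>1) (\<psi> i n \<sigma>\<^sub>2) < \<epsilon>) \<and>
             \<psi> i n \<sigma>\<^sub>1 \<otimes>\<^bsub>G (j i n)\<^esub> \<tau> i n g \<otimes>\<^bsub>G (j i n)\<^esub> inv\<^bsub>G (j i n)\<^esub> \<psi> i n \<sigma>\<^sub>1
               = \<tau> i n (\<lambda>x\<in>{1..n}. g ((inv\<^bsub>BijGroup {1..n}\<^esub> \<sigma>\<^sub>1) x))"
    using wreath unfolding wreath_compatible_def by blast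
  \<comment> \<open>Half of \<open>\<epsilon>\<close> for the \<open>\<tau>\<close> factor and half
    for the \<open>\<psi>\<close> factor; the cap \<open>1 / 2\<close> keeps
    \<open>(1 - \<epsilon>') * c\<close> at least \<open>c / 2\<close>.\<close>
  define \<epsilon>' where "\<epsilon>' = min (\<epsilon> / 2) (1 / 2)"
  have \<epsilon>': "\<epsilon>' > 0" "2 * \<epsilon>' \<le> \<epsilon>" "(1 - \<epsilon>') * c \<ge> c / 2"
    using \<epsilon> c by (auto simp: \<epsilon>'_def min_def field_simps)
  \<comment> \<open>Since \<open>\<delta>\<close> depends on \<open>\<epsilon>'\<close> only, it can
    be fixed before \<open>n\<close> and \<open>i\<close>, both of which are chosen in terms of
    it.\<close>
  from W \<epsilon>'(1) obtain \<delta> where \<delta>: "\<delta> > 0" and W': "\<forall>i\<in>I. \<forall>n. \<forall>c>0.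
           \<forall>g \<in> carrier (product_group {1..n} (\<lambda>_. G i)).
           \<forall>g' \<in> carrier (product_group {1..n} (\<lambda>_. G i)).
           \<forall>\<sigma>\<^sub>1 \<in> carrier (BijGroup {1..n}). \<forall>\<sigma>\<^sub>2 \<in> carrier (BijGroup {1..n}).
             (\<forall>X \<subseteq> {1..n}. real (card X) > (1 - \<delta>) * real n \<longrightarrow>
                ((\<forall>x\<in>X. d i (g x) (g' x) < \<delta>) \<longrightarrow> d (j i n) (\<tau> i n g) (\<tau> i n g') < \<epsilon>') \<and>
                ((\<forall>x\<in>X. d i (g x) (g' x) > c) \<longrightarrow> d (j i n) (\<tau> i n g) (\<tau> i n g') > (1 - \<epsilon>') * c)) \<and>
             (hamming {1..n} \<sigma>\<^sub>1 \<sigma>\<^sub>2 < \<delta> \<longrightarrow> d (j i n) (\<psi> i n \<sigma>\<^sub>1) (\<psi> i n \<sigma>\<^sub>2) < \<epsilon>') \<and>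
             \<psi> i n \<sigma>\<^sub>1 \<otimes>\<^bsub>G (j i n)\<^esub> \<tau> i n g \<otimes>\<^bsub>G (j i n)\<^esub> inv\<^bsub>G (j i n)\<^esub> \<psi> i n \<sigma>\<^sub>1
               = \<tau> i n (\<lambda>x\<in>{1..n}. g ((inv\<^bsub>BijGroup {1..n}\<^esub> \<sigma>\<^sub>1) x))"
    by blast

  define K where "K = snd ` F"
  define H where "H = fst ` F"
  \<comment> \<open>For a product in \<open>F\<close>, \<open>E\<close> must contain
    \<open>h\<close>, the translate \<open>\<beta> g h'\<close> and their product; the product is a
    first coordinate of \<open>F\<close>, hence in \<open>H\<close>. The unit lets the maps
    \<open>\<pi>\<close> be compared with the unit of \<open>\<Lambda>\<close>.\<close>
  define E where "E = insert \<one>\<^bsub>\<Delta>\<^esub> (H \<union> (\<lambda>(g, h). \<beta> g h) ` (K \<times> H))"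
  have K: "finite K" "K \<subseteq> carrier \<Gamma>" and H: "finite H" "H \<subseteq> carrier \<Delta>"
    using F by (auto simp: K_def H_def semidirect_product_def)
  have E: "finite E" "E \<subseteq> carrier \<Delta>"
    using K H \<beta>D(2) by (auto simp: E_def)
  \<comment> \<open>The tolerance \<open>\<delta> / 2\<close> allows for passing from
    \<open>S\<close> to its intersection with a permuted copy, which leaves more than
    \<open>(1 - \<delta>) * n\<close> points.\<close>
  obtain \<Lambda> :: "'l monoid" and n \<phi> where \<Lambda>: "\<Lambda> \<in> approximable_groups_with I G d c"
    and \<phi>: "\<phi> \<in> carrier \<Gamma> \<rightarrow> Bij {1..n::nat}" "unital \<Gamma> (BijGroup {1..n}) \<phi>"
      "multiplicative \<Gamma> (BijGroup {1..n}) (hamming {1..n}) K (\<delta> / 2) \<phi>"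
    and appr: "automorphic_approximation \<Delta> \<beta> K E (\<delta> / 2) \<Lambda> {1..n} \<phi>"
    using sofic_action_interval[OF sofic K E half_gt_zero[OF \<delta>]] .
  interpret \<Lambda>: group \<Lambda>
    using \<Lambda> by (simp add: approximable_groups_with_def)
  from appr obtain S \<pi> where S: "S \<subseteq> {1..n}" and large: "real (card S) > (1 - \<delta> / 2) * real n"
    and \<pi>': "\<forall>s\<in>S. partial_hom \<Delta> E \<Lambda> (\<pi> s) \<and> inj_on (\<pi> s) E"
    and \<pi>_eq: "\<forall>g\<in>K. \<forall>h\<in>E. \<forall>s\<in>S. \<phi> g s \<in> S \<and> (inv\<^bsub>AutoGroup \<Delta>\<^esub> (\<beta> g)) h \<in> E \<longrightarrow>
        \<pi> (\<phi> g s) h = \<pi> s ((inv\<^bsub>AutoGroup \<Delta>\<^esub> (\<beta> g)) h)"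
    unfolding automorphic_approximation_def by auto
  have \<pi>: "partial_hom \<Delta> E \<Lambda> (\<pi> s)" "inj_on (\<pi> s) E" if "s \<in> S" for s
    using \<pi>' that by auto
  have \<pi>_closed: "\<pi> s h \<in> carrier \<Lambda>" if "s \<in> S" "h \<in> E" for s h
    using \<pi>(1) that by (auto simp: partial_hom_def)
  have \<pi>_mult: "\<pi> s (h \<otimes>\<^bsub>\<Delta>\<^esub> h') = \<pi> s h \<otimes>\<^bsub>\<Lambda>\<^esub> \<pi> s h'"
    if "s \<in> S" "h \<in> E" "h' \<in> E" "h \<otimes>\<^bsub>\<Delta>\<^esub> h' \<in> E" for s h h'
    using \<pi>(1) that by (auto simp: partial_hom_def)
  have oneE: "\<one>\<^bsub>\<Delta>\<^esub> \<in> E"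
    by (simp add: E_def)
  \<comment> \<open>The value at the unit is idempotent in the group
    \<open>\<Lambda>\<close>.\<close>
  have \<pi>_one: "\<pi> s \<one>\<^bsub>\<Delta>\<^esub> = \<one>\<^bsub>\<Lambda>\<^esub>" if "s \<in> S" for s
    using \<pi>_mult[OF that oneE oneE] \<pi>_closed[OF that oneE] oneE by simp

  \<comment> \<open>With \<open>n\<close> fixed there are finitely many values of the maps
    \<open>\<pi> s\<close> on \<open>E\<close>, so a single \<open>\<theta>\<close> serves all
    coordinates.\<close>
  define L where "L = (\<Union>s\<in>S. \<pi> s ` E)"
  have L: "finite L" "L \<subseteq> carrier \<Lambda>"
    using E(1) finite_subset[OF S] \<pi>_closed by (auto simp: L_def)
  obtain i \<theta> where i: "i \<in> I" and \<theta>: "\<theta> \<in> carrier \<Lambda> \<rightarrow> carrier (G i)"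
    and \<theta>_one: "\<theta> \<one>\<^bsub>\<Lambda>\<^esub> = \<one>\<^bsub>G i\<^esub>"
    and \<theta>_mult: "\<And>x y. \<lbrakk>x \<in> L; y \<in> L; x \<otimes>\<^bsub>\<Lambda>\<^esub> y \<in> L\<rbrakk>
        \<Longrightarrow> d i (\<theta> (x \<otimes>\<^bsub>\<Lambda>\<^esub> y)) (\<theta> x \<otimes>\<^bsub>G i\<^esub> \<theta> y) < \<delta>"
    and \<theta>_sep: "\<And>x. x \<in> L \<Longrightarrow> x \<noteq> \<one>\<^bsub>\<Lambda>\<^esub> \<Longrightarrow> d i (\<theta> x) \<one>\<^bsub>G i\<^esub> > c"
  proof -
    have "approximable_with I G d c \<Lambda>"
      using \<Lambda> by (simp add: approximable_groups_with_def)
    from approximable_withE[OF this L \<delta>] obtain i \<theta> where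
      "i \<in> I" "\<theta> \<in> carrier \<Lambda> \<rightarrow> carrier (G i)" "unital \<Lambda> (G i) \<theta>"
      "multiplicative \<Lambda> (G i) (d i) L \<delta> \<theta>" "separating \<Lambda> (G i) (d i) L c \<theta>" .
    then show thesis
      using that unfolding unital_def multiplicative_def separating_def by blast
  qed

  define k where "k = j i n"
  have k: "k \<in> I"
    using i j by (simp add: k_def)
  interpret Gi: group "G i"
    using fam i by (simp add: metric_family_def)
  interpret Gk: group "G k"
    using fam k by (simp add: metric_family_def)
  interpret Sn: group "BijGroup {1..n}"
    by (rule group_BijGroup)
  let ?P = "product_group {1..n} (\<lambda>_. G i)"
  let ?D = "semidirect_product \<Delta> \<Gamma> \<beta>"
  have P: "group ?P"
    by (simp add: Gi.group_axioms)
  interpret \<tau>: group_hom ?P "G k" "\<tau> i n"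
    using P Gk.group_axioms \<tau>[OF i, of n]
    by (simp add: group_hom_def group_hom_axioms_def k_def)
  interpret \<psi>: group_hom "BijGroup {1..n}" "G k" "\<psi> i n"
    using Sn.group_axioms Gk.group_axioms \<psi>[OF i, of n]
    by (simp add: group_hom_def group_hom_axioms_def k_def)
  have W'': "\<forall>c>0. \<forall>g \<in> carrier ?P. \<forall>g' \<in> carrier ?P. \<forall>\<sigma>\<^sub>1 \<in> Bij {1..n}. \<forall>\<sigma>\<^sub>2 \<in> Bij {1..n}.
             (\<forall>X \<subseteq> {1..n}. real (card X) > (1 - \<delta>) * real n \<longrightarrow>
                ((\<forall>x\<in>X. d i (g x) (g' x) < \<delta>) \<longrightarrow> d k (\<tau> i n g) (\<tau> i n g') < \<epsilon>') \<and>
                ((\<forall>x\<in>X. d i (g x) (g' x) > c) \<longrightarrow> d k (\<tau> i n g) (\<tau> i n g') > (1 - \<epsilon>') * c)) \<and>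
             (hamming {1..n} \<sigma>\<^sub>1 \<sigma>\<^sub>2 < \<delta> \<longrightarrow> d k (\<psi> i n \<sigma>\<^sub>1) (\<psi> i n \<sigma>\<^sub>2) < \<epsilon>') \<and>
             \<psi> i n \<sigma>\<^sub>1 \<otimes>\<^bsub>G k\<^esub> \<tau> i n g \<otimes>\<^bsub>G k\<^esub> inv\<^bsub>G k\<^esub> \<psi> i n \<sigma>\<^sub>1
               = \<tau> i n (\<lambda>x\<in>{1..n}. g ((inv\<^bsub>BijGroup {1..n}\<^esub> \<sigma>\<^sub>1) x))"
    using bspec[OF W' i] unfolding k_def carrier_BijGroup by blast
  \<comment> \<open>The clauses of \<open>W''\<close> share one block of quantifiers. The identity
    permutation, and further down the unit tuple, instantiate the variables that the extracted
    clause does not mention.\<close>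
  have id: "(\<lambda>x\<in>{1..n}. x) \<in> Bij {1..n}"
    by (rule id_Bij)
  have \<tau>_close: "d k (\<tau> i n g) (\<tau> i n g') < \<epsilon>'"
    if "g \<in> carrier ?P" "g' \<in> carrier ?P" "X \<subseteq> {1..n}" "real (card X) > (1 - \<delta>) * real n"
      "\<And>x. x \<in> X \<Longrightarrow> d i (g x) (g' x) < \<delta>" for g g' X
    using W'' c that id by blast
  have \<tau>_far: "d k (\<tau> i n g) (\<tau> i n g') > (1 - \<epsilon>') * c"
    if "g \<in> carrier ?P" "g' \<in> carrier ?P" "X \<subseteq> {1..n}" "real (card X) > (1 - \<delta>) * real n"
      "\<And>x. x \<in> X \<Longrightarrow> d i (g x) (g' x) > c" for g g' X
    using W'' c that id by blast
  have one_P: "\<one>\<^bsub>?P\<^esub> \<in> carrier ?P"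
    using P by (simp add: group.is_monoid)
  have \<psi>_close: "d k (\<psi> i n \<sigma>\<^sub>1) (\<psi> i n \<sigma>\<^sub>2) < \<epsilon>'"
    if "\<sigma>\<^sub>1 \<in> Bij {1..n}" "\<sigma>\<^sub>2 \<in> Bij {1..n}" "hamming {1..n} \<sigma>\<^sub>1 \<sigma>\<^sub>2 < \<delta>" for \<sigma>\<^sub>1 \<sigma>\<^sub>2
    using W'' c that one_P by blast
  have conj: "\<psi> i n \<sigma> \<otimes>\<^bsub>G k\<^esub> \<tau> i n g \<otimes>\<^bsub>G k\<^esub> inv\<^bsub>G k\<^esub> \<psi> i n \<sigma>
      = \<tau> i n (\<lambda>x\<in>{1..n}. g ((inv\<^bsub>BijGroup {1..n}\<^esub> \<sigma>) x))"
    if "\<sigma> \<in> Bij {1..n}" "g \<in> carrier ?P" for \<sigma> g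
    using W'' c that by blast

  \<comment> \<open>The default unit makes \<open>\<eta> h\<close> a tuple of the product for every
    \<open>h\<close> and makes \<open>\<eta>\<close> exactly unital, also at coordinates outside
    \<open>S\<close>.\<close>
  define \<eta> where "\<eta> h = (\<lambda>x\<in>{1..n}. if x \<in> S \<and> h \<in> E then \<theta> (\<pi> x h) else \<one>\<^bsub>G i\<^esub>)" for h
  have \<eta>: "\<eta> h \<in> carrier ?P" for h
    using funcset_mem[OF \<theta> \<pi>_closed] by (auto simp: \<eta>_def)
  have \<eta>_one: "\<eta> \<one>\<^bsub>\<Delta>\<^esub> = \<one>\<^bsub>?P\<^esub>"
    using \<pi>_one \<theta>_one by (auto simp: \<eta>_def)
  have \<eta>_S: "\<eta> h x = \<theta> (\<pi> x h)" if "x \<in> S" "h \<in> E" for x h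
    using that S by (auto simp: \<eta>_def)
  define \<Theta> where "\<Theta> = (\<lambda>(h, g). \<tau> i n (\<eta> h) \<otimes>\<^bsub>G k\<^esub> \<psi> i n (\<phi> g))"
  have \<phi>_car: "\<phi> g \<in> carrier (BijGroup {1..n})" if "g \<in> carrier \<Gamma>" for g
    using \<phi>(1) that by (auto simp: carrier_BijGroup)
  have \<Theta>_closed: "\<Theta> \<in> carrier ?D \<rightarrow> carrier (G k)"
    using \<tau>.hom_closed[OF \<eta>] \<psi>.hom_closed[OF \<phi>_car]
    by (auto simp: \<Theta>_def semidirect_product_def)
  \<comment> \<open>As \<open>\<phi>\<close> is unital, the permutation factor vanishes on
    \<open>\<Delta>\<close>, and separation there becomes a statement about
    \<open>\<tau>\<close>.\<close>
  have \<Theta>_1: "\<Theta> (h, \<one>\<^bsub>\<Gamma>\<^esub>) = \<tau> i n (\<eta> h)" for h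
    using \<phi>(2) \<tau>.hom_closed[OF \<eta>] by (simp add: \<Theta>_def unital_def)
  show thesis
  proof (rule that[OF k \<Theta>_closed])
    have "\<Theta> (\<one>\<^bsub>\<Delta>\<^esub>, \<one>\<^bsub>\<Gamma>\<^esub>) = \<one>\<^bsub>G k\<^esub>"
      unfolding \<Theta>_1 \<eta>_one by (rule \<tau>.hom_one)
    then show "unital ?D (G k) \<Theta>"
      by (simp add: unital_def semidirect_product_def)
  next
    show "\<forall>h. (h, \<one>\<^bsub>\<Gamma>\<^esub>) \<in> F \<longrightarrow> h \<noteq> \<one>\<^bsub>\<Delta>\<^esub> \<longrightarrow> d k (\<Theta> (h, \<one>\<^bsub>\<Gamma>\<^esub>)) \<one>\<^bsub>G k\<^esub> > c / 2"
    proof (intro allI impI)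
      fix h assume h: "(h, \<one>\<^bsub>\<Gamma>\<^esub>) \<in> F" "h \<noteq> \<one>\<^bsub>\<Delta>\<^esub>"
      then have hE: "h \<in> E"
        by (force simp: E_def H_def)
      have "(1 - \<delta>) * real n \<le> (1 - \<delta> / 2) * real n"
        using \<delta> by (intro mult_right_mono) auto
      with large have "real (card S) > (1 - \<delta>) * real n"
        by linarith
      moreover have "d i (\<eta> h x) (\<one>\<^bsub>?P\<^esub> x) > c" if x: "x \<in> S" for x
      proof -
        \<comment> \<open>Injectivity of \<open>\<pi> x\<close> on \<open>E\<close>, which contains
          both \<open>h\<close> and the unit. Thus \<open>\<theta>\<close> separates at every
          coordinate in \<open>S\<close>.\<close>
        have "\<pi> x h \<noteq> \<one>\<^bsub>\<Lambda>\<^esub>"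
          using \<pi>(2)[OF x] \<pi>_one[OF x] hE oneE h(2) by (metis inj_onD)
        moreover have "\<pi> x h \<in> L"
          using x hE by (auto simp: L_def)
        ultimately show ?thesis
          using \<theta>_sep \<eta>_S[OF x hE] x S by auto
      qed
      ultimately have "d k (\<tau> i n (\<eta> h)) (\<tau> i n \<one>\<^bsub>?P\<^esub>) > (1 - \<epsilon>') * c"
        using \<tau>_far[OF \<eta> one_P S] by blast
      then show "d k (\<Theta> (h, \<one>\<^bsub>\<Gamma>\<^esub>)) \<one>\<^bsub>G k\<^esub> > c / 2"
        using \<epsilon>'(3) unfolding \<Theta>_1 \<tau>.hom_one by linarith
    qed
  next
    show "multiplicative ?D (G k) (d k) F \<epsilon> \<Theta>"
      unfolding multiplicative_def
    proof (intro ballI impI)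
      fix a b assume ab: "a \<in> F" "b \<in> F" "a \<otimes>\<^bsub>?D\<^esub> b \<in> F"
      obtain h g where a: "a = (h, g)" by fastforce
      obtain h' g' where b: "b = (h', g')" by fastforce
      have abF: "a \<otimes>\<^bsub>?D\<^esub> b = (h \<otimes>\<^bsub>\<Delta>\<^esub> \<beta> g h', g \<otimes>\<^bsub>\<Gamma>\<^esub> g')"
        by (simp add: a b semidirect_product_def)
      have gK: "g \<in> K" "g' \<in> K" "g \<otimes>\<^bsub>\<Gamma>\<^esub> g' \<in> K" and hH: "h \<in> H" "h' \<in> H"
        and hE: "h \<otimes>\<^bsub>\<Delta>\<^esub> \<beta> g h' \<in> E"
        using ab unfolding abF unfolding a b by (force simp: K_def H_def E_def)+
      have hE': "h \<in> E" "h' \<in> E" "\<beta> g h' \<in> E"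
        using gK hH by (auto simp: E_def)
      have g: "g \<in> carrier \<Gamma>" "g' \<in> carrier \<Gamma>" and h': "h' \<in> carrier \<Delta>"
        using gK hH K H by auto
      let ?\<sigma> = "\<phi> g"
      have \<sigma>: "?\<sigma> \<in> Bij {1..n}"
        using \<phi>_car[OF g(1)] by (simp add: carrier_BijGroup)
      have inv_\<sigma>: "(inv\<^bsub>BijGroup {1..n}\<^esub> ?\<sigma>) (?\<sigma> s) = s" if "s \<in> {1..n}" for s
      proof -
        have "bij_betw ?\<sigma> {1..n} {1..n}"
          using \<sigma> by (simp add: Bij_def)
        then show ?thesis
          using inv_BijGroup[OF \<sigma>] that bij_betwE bij_betw_inv_into_left by fastforce
      qed
      define \<eta>' where "\<eta>' = (\<lambda>x\<in>{1..n}. \<eta> h' ((inv\<^bsub>BijGroup {1..n}\<^esub> ?\<sigma>) x))"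
      have "inv\<^bsub>BijGroup {1..n}\<^esub> ?\<sigma> \<in> Bij {1..n}"
        using Sn.inv_closed[OF \<phi>_car[OF g(1)]] by (simp add: carrier_BijGroup)
      then have \<eta>': "\<eta>' \<in> carrier ?P"
        using \<eta>[of h'] Bij_imp_funcset by (fastforce simp: \<eta>'_def PiE_iff)
      have \<eta>\<eta>': "\<eta> h \<otimes>\<^bsub>?P\<^esub> \<eta>' \<in> carrier ?P"
        using \<eta> \<eta>' P by (intro monoid.m_closed) (auto simp: group.is_monoid simp del: carrier_product_group)

      note car = \<tau>.hom_closed[OF \<eta>] \<tau>.hom_closed[OF \<eta>'] \<psi>.hom_closed[OF \<phi>_car[OF g(1)]]
        \<psi>.hom_closed[OF \<phi>_car[OF g(2)]]
      \<comment> \<open>The conjugation clause, solved for the product: moving \<open>\<psi>\<close>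
        to the right past \<open>\<tau>\<close> permutes the tuple, just as moving \<open>g\<close>
        past \<open>h'\<close> in the semidirect product applies \<open>\<beta> g\<close>.\<close>
      have "\<psi> i n ?\<sigma> \<otimes>\<^bsub>G k\<^esub> \<tau> i n (\<eta> h') = \<tau> i n \<eta>' \<otimes>\<^bsub>G k\<^esub> \<psi> i n ?\<sigma>"
        using conj[OF \<sigma> \<eta>[of h']] car by (simp add: \<eta>'_def Gk.inv_solve_right')
      then have "\<Theta> a \<otimes>\<^bsub>G k\<^esub> \<Theta> b
          = (\<tau> i n (\<eta> h) \<otimes>\<^bsub>G k\<^esub> \<tau> i n \<eta>') \<otimes>\<^bsub>G k\<^esub> (\<psi> i n ?\<sigma> \<otimes>\<^bsub>G k\<^esub> \<psi> i n (\<phi> g'))"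
        using car by (simp add: a b \<Theta>_def Gk.m_assoc) (simp add: Gk.m_assoc[symmetric])
      also have "\<dots> = \<tau> i n (\<eta> h \<otimes>\<^bsub>?P\<^esub> \<eta>') \<otimes>\<^bsub>G k\<^esub> \<psi> i n (?\<sigma> \<otimes>\<^bsub>BijGroup {1..n}\<^esub> \<phi> g')"
        using \<tau>.hom_mult[OF \<eta> \<eta>', of h] \<psi>.hom_mult[OF \<phi>_car[OF g(1)] \<phi>_car[OF g(2)]]
        by (simp del: mult_product_group)
      finally have prod: "\<Theta> a \<otimes>\<^bsub>G k\<^esub> \<Theta> b
          = \<tau> i n (\<eta> h \<otimes>\<^bsub>?P\<^esub> \<eta>') \<otimes>\<^bsub>G k\<^esub> \<psi> i n (?\<sigma> \<otimes>\<^bsub>BijGroup {1..n}\<^esub> \<phi> g')" .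

      \<comment> \<open>At \<open>x = ?\<sigma> s\<close> the permuted tuple \<open>\<eta>'\<close>
        has the entry \<open>\<theta> (\<pi> s h')\<close>. Equivariance rewrites it as
        \<open>\<theta> (\<pi> x (\<beta> g h'))\<close>, leaving only the multiplicativity error of
        \<open>\<theta>\<close>.\<close>
      have close: "d i (\<eta> (h \<otimes>\<^bsub>\<Delta>\<^esub> \<beta> g h') x) ((\<eta> h \<otimes>\<^bsub>?P\<^esub> \<eta>') x) < \<delta>" if x: "x \<in> S \<inter> ?\<sigma> ` S" for x
      proof -
        from x obtain s where s: "s \<in> S" "x = ?\<sigma> s" "x \<in> S" by auto
        have inv_\<beta>: "(inv\<^bsub>AutoGroup \<Delta>\<^esub> (\<beta> g)) (\<beta> g h') = h'"
          using AutoGroup_inv_apply[OF \<Delta> hom_in_carrier[OF \<beta> g(1)] h'] .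
        have "\<pi> x (\<beta> g h') = \<pi> s h'"
          \<comment> \<open>Equivariance is applied to the element \<open>\<beta> g h'\<close>,
            which the inverse automorphism takes back to \<open>h'\<close>.\<close>
          using \<pi>_eq gK(1) hE'(3) s inv_\<beta> hE'(2) by metis
        moreover have "\<pi> x (h \<otimes>\<^bsub>\<Delta>\<^esub> \<beta> g h') = \<pi> x h \<otimes>\<^bsub>\<Lambda>\<^esub> \<pi> x (\<beta> g h')"
          by (rule \<pi>_mult[OF s(3) hE'(1,3) hE])
        moreover have "\<pi> x h \<in> L" "\<pi> x (\<beta> g h') \<in> L" "\<pi> x (h \<otimes>\<^bsub>\<Delta>\<^esub> \<beta> g h') \<in> L"
          using s(3) hE hE' unfolding L_def by blast+
        ultimately have "d i (\<theta> (\<pi> x (h \<otimes>\<^bsub>\<Delta>\<^esub> \<beta> g h'))) (\<theta> (\<pi> x h) \<otimes>\<^bsub>G i\<^esub> \<theta> (\<pi> s h')) < \<delta>"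
          using \<theta>_mult[of "\<pi> x h" "\<pi> x (\<beta> g h')"] by simp
        moreover have "\<eta>' x = \<theta> (\<pi> s h')"
          using s S inv_\<sigma>[of s] \<eta>_S[OF s(1) hE'(2)] by (auto simp: \<eta>'_def)
        moreover have "x \<in> {1..n}"
          using s(3) S by blast
        ultimately show ?thesis
          using \<eta>_S[OF s(3) hE] \<eta>_S[OF s(3) hE'(1)] by simp
      qed
      have "S \<inter> ?\<sigma> ` S \<subseteq> {1..n}"
        using S by blast
      then have 1: "d k (\<tau> i n (\<eta> (h \<otimes>\<^bsub>\<Delta>\<^esub> \<beta> g h'))) (\<tau> i n (\<eta> h \<otimes>\<^bsub>?P\<^esub> \<eta>')) < \<epsilon>'"
        by (rule \<tau>_close[OF \<eta> \<eta>\<eta>' _ card_Int_perm_image[OF S \<sigma> large] close])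

      have gg': "g \<otimes>\<^bsub>\<Gamma>\<^esub> g' \<in> carrier \<Gamma>"
        using g by simp
      have \<sigma>\<sigma>': "?\<sigma> \<otimes>\<^bsub>BijGroup {1..n}\<^esub> \<phi> g' \<in> carrier (BijGroup {1..n})"
        using \<phi>_car g by simp
      have "hamming {1..n} (\<phi> (g \<otimes>\<^bsub>\<Gamma>\<^esub> g')) (?\<sigma> \<otimes>\<^bsub>BijGroup {1..n}\<^esub> \<phi> g') < \<delta>"
        using \<phi>(3) gK \<delta> unfolding multiplicative_def by fastforce
      then have 2: "d k (\<psi> i n (\<phi> (g \<otimes>\<^bsub>\<Gamma>\<^esub> g'))) (\<psi> i n (?\<sigma> \<otimes>\<^bsub>BijGroup {1..n}\<^esub> \<phi> g')) < \<epsilon>'"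
        using \<phi>_car[OF gg'] \<sigma>\<sigma>' by (intro \<psi>_close) (simp_all add: carrier_BijGroup)

      \<comment> \<open>Both sides are now a \<open>\<tau>\<close> value times a
        \<open>\<psi>\<close> value, so by bi-invariance the two errors add.\<close>
      have "d k (\<Theta> (a \<otimes>\<^bsub>?D\<^esub> b)) (\<Theta> a \<otimes>\<^bsub>G k\<^esub> \<Theta> b)
          \<le> d k (\<tau> i n (\<eta> (h \<otimes>\<^bsub>\<Delta>\<^esub> \<beta> g h'))) (\<tau> i n (\<eta> h \<otimes>\<^bsub>?P\<^esub> \<eta>'))
            + d k (\<psi> i n (\<phi> (g \<otimes>\<^bsub>\<Gamma>\<^esub> g'))) (\<psi> i n (?\<sigma> \<otimes>\<^bsub>BijGroup {1..n}\<^esub> \<phi> g'))"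
        unfolding prod abF unfolding \<Theta>_def prod.case
        using fam k \<tau>.hom_closed[OF \<eta>] \<tau>.hom_closed[OF \<eta>\<eta>']
          \<psi>.hom_closed[OF \<phi>_car[OF gg']] \<psi>.hom_closed[OF \<sigma>\<sigma>']
        by (intro bi_invariant_mult_le) (simp_all add: metric_family_def)
      then show "d k (\<Theta> (a \<otimes>\<^bsub>?D\<^esub> b)) (\<Theta> a \<otimes>\<^bsub>G k\<^esub> \<Theta> b) < \<epsilon>"
        using 1 2 \<epsilon>'(2) by linarith
    qed
  qed
qed

section \<open>Joining the wreath map with an approximation of the quotient \<Gamma>\<close>

theorem theorem5p1:
  fixes I :: "'i set" and G :: "'i \<Rightarrow> 'a monoid" and d :: "'i \<Rightarrow> 'a \<Rightarrow> 'a \<Rightarrow> real"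
    and \<Gamma> :: "'g monoid" and \<Delta> :: "'d monoid" and \<beta> :: "'g \<Rightarrow> 'd \<Rightarrow> 'd" and c :: real
  assumes "metric_family I G d"
    and "product_compatible I G d"
    and "wreath_compatible I G d"
    and "\<Gamma> \<in> approximable_groups I G d"
    and "\<Delta> \<in> approximable_groups I G d"
    and "c > 0"
    and "sofic_action (approximable_groups_with I G d c :: 'l monoid set) \<Gamma> \<Delta> \<beta>"
  shows "semidirect_product \<Delta> \<Gamma> \<beta> \<in> approximable_groups I G d"
proof -
  have \<Gamma>: "group \<Gamma>" and \<Delta>: "group \<Delta>"
    using assms(4,5) by (simp_all add: approximable_groups_def)
  have \<beta>: "\<beta> \<in> hom \<Gamma> (AutoGroup \<Delta>)"
    using assms(7) by (simp add: sofic_action_def)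
  let ?D = "semidirect_product \<Delta> \<Gamma> \<beta>"
  obtain c' where c': "c' > 0" "approximable_with I G d c' \<Gamma>"
    using assms(4) by (auto simp: approximable_groups_def approximable_def)
  obtain \<mu> k D where \<mu>: "\<mu> > 0"
    and kD: "\<forall>i\<in>I. \<forall>j\<in>I. k i j \<in> I \<and> D i j \<in> hom (G i \<times>\<times> G j) (G (k i j))"
    and upper: "\<forall>\<epsilon>>0. \<exists>\<delta>>0. \<forall>i\<in>I. \<forall>j\<in>I.
           \<forall>x\<in>carrier (G i). \<forall>x'\<in>carrier (G i). \<forall>y\<in>carrier (G j). \<forall>y'\<in>carrier (G j).
             d i x x' < \<delta> \<and> d j y y' < \<delta> \<longrightarrow>
             d (k i j) (D i j (x, y)) (D i j (x', y')) < \<epsilon>"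
    and lower: "\<forall>i\<in>I. \<forall>j\<in>I.
           \<forall>x\<in>carrier (G i). \<forall>x'\<in>carrier (G i). \<forall>y\<in>carrier (G j). \<forall>y'\<in>carrier (G j).
             d (k i j) (D i j (x, y)) (D i j (x', y')) \<ge> \<mu> * max (d i x x') (d j y y')"
    using assms(2) unfolding product_compatible_def by (elim exE conjE) (rule that)
  \<comment> \<open>\<open>c / 2\<close> is the separation on \<Delta>, \<open>c'\<close> the one
    off \<Delta>, and \<open>\<mu>\<close> the factor by which the joining homomorphism may shrink
    distances. All are fixed before \<open>F\<close> and \<open>\<epsilon>\<close>.\<close>
  define C where "C = \<mu> * min c' (c / 2)"
  have "approximable_with I G d C ?D"
    unfolding approximable_with_def
  proof (intro allI impI, elim conjE)
    fix F :: "('d \<times> 'g) set" and \<epsilon> :: real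
    assume F: "finite F" "F \<subseteq> carrier ?D" and "\<epsilon> > 0"
    \<comment> \<open>Uniformity over all pairs of indices lets \<open>\<delta>\<close> be chosen
      before the two approximations that determine \<open>i\<close> and \<open>j\<close>.\<close>
    obtain \<delta> where \<delta>: "\<delta> > 0" and close: "\<And>i j x x' y y'. \<lbrakk>i \<in> I; j \<in> I; x \<in> carrier (G i);
           x' \<in> carrier (G i); y \<in> carrier (G j); y' \<in> carrier (G j); d i x x' < \<delta>; d j y y' < \<delta>\<rbrakk>
           \<Longrightarrow> d (k i j) (D i j (x, y)) (D i j (x', y')) < \<epsilon>"
      using upper \<open>\<epsilon> > 0\<close> by meson
    obtain i \<Theta> where i: "i \<in> I" and \<Theta>: "\<Theta> \<in> carrier ?D \<rightarrow> carrier (G i)"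
      "unital ?D (G i) \<Theta>" "multiplicative ?D (G i) (d i) F \<delta> \<Theta>"
      and \<Theta>_sep: "\<forall>h. (h, \<one>\<^bsub>\<Gamma>\<^esub>) \<in> F \<longrightarrow> h \<noteq> \<one>\<^bsub>\<Delta>\<^esub> \<longrightarrow> d i (\<Theta> (h, \<one>\<^bsub>\<Gamma>\<^esub>)) \<one>\<^bsub>G i\<^esub> > c / 2"
      using sofic_action_wreath_approximation[OF assms(1,3) \<Gamma> \<Delta> assms(6,7) F \<delta>] .
    have K: "finite (snd ` F)" "snd ` F \<subseteq> carrier \<Gamma>"
      using F by (auto simp: semidirect_product_def)
    obtain j \<rho> where j: "j \<in> I" and \<rho>: "\<rho> \<in> carrier \<Gamma> \<rightarrow> carrier (G j)"
      "unital \<Gamma> (G j) \<rho>" "multiplicative \<Gamma> (G j) (d j) (snd ` F) \<delta> \<rho>"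
      "separating \<Gamma> (G j) (d j) (snd ` F) c' \<rho>"
      using approximable_withE[OF c'(2) K \<delta>] .
    have k: "k i j \<in> I" and D: "D i j \<in> hom (G i \<times>\<times> G j) (G (k i j))"
      using kD i j by auto
    interpret Gi: group "G i"
      using assms(1) i by (simp add: metric_family_def)
    interpret Gj: group "G j"
      using assms(1) j by (simp add: metric_family_def)
    interpret Gk: group "G (k i j)"
      using assms(1) k by (simp add: metric_family_def)
    interpret D: group_hom "G i \<times>\<times> G j" "G (k i j)" "D i j"
      using D DirProd_group[OF Gi.group_axioms Gj.group_axioms] Gk.group_axioms
      by (simp add: group_hom_def group_hom_axioms_def)
    define \<Phi> where "\<Phi> = (\<lambda>x. D i j (\<Theta> x, \<rho> (snd x)))"
    have car: "\<Theta> x \<in> carrier (G i)" "\<rho> (snd x) \<in> carrier (G j)" if "x \<in> carrier ?D" for x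
      using that \<Theta>(1) \<rho>(1) by (auto simp: semidirect_product_def)
    have "\<Phi> \<in> carrier ?D \<rightarrow> carrier (G (k i j))"
      using car by (auto simp: \<Phi>_def)
    moreover have "unital ?D (G (k i j)) \<Phi>"
      using \<Theta>(2) \<rho>(2) D.hom_one by (simp add: unital_def \<Phi>_def semidirect_product_def)
    moreover have "multiplicative ?D (G (k i j)) (d (k i j)) F \<epsilon> \<Phi>"
      unfolding multiplicative_def
    proof (intro ballI impI)
      fix a b assume ab: "a \<in> F" "b \<in> F" "a \<otimes>\<^bsub>?D\<^esub> b \<in> F"
      have snd: "snd (a \<otimes>\<^bsub>?D\<^esub> b) = snd a \<otimes>\<^bsub>\<Gamma>\<^esub> snd b"
        by (simp add: semidirect_product_def split: prod.split)
      have carF: "a \<in> carrier ?D" "b \<in> carrier ?D" "a \<otimes>\<^bsub>?D\<^esub> b \<in> carrier ?D"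
        using ab F(2) by auto
      have "\<Phi> a \<otimes>\<^bsub>G (k i j)\<^esub> \<Phi> b = D i j (\<Theta> a \<otimes>\<^bsub>G i\<^esub> \<Theta> b, \<rho> (snd a) \<otimes>\<^bsub>G j\<^esub> \<rho> (snd b))"
        unfolding \<Phi>_def using car carF by (subst D.hom_mult[symmetric]) auto
      moreover have "d i (\<Theta> (a \<otimes>\<^bsub>?D\<^esub> b)) (\<Theta> a \<otimes>\<^bsub>G i\<^esub> \<Theta> b) < \<delta>"
        using \<Theta>(3) ab by (simp add: multiplicative_def)
      moreover have "d j (\<rho> (snd (a \<otimes>\<^bsub>?D\<^esub> b))) (\<rho> (snd a) \<otimes>\<^bsub>G j\<^esub> \<rho> (snd b)) < \<delta>"
        using \<rho>(3) ab imageI[OF ab(3), of snd] unfolding snd multiplicative_def by simp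
      ultimately show "d (k i j) (\<Phi> (a \<otimes>\<^bsub>?D\<^esub> b)) (\<Phi> a \<otimes>\<^bsub>G (k i j)\<^esub> \<Phi> b) < \<epsilon>"
        unfolding \<Phi>_def using car[OF carF(1)] car[OF carF(2)] car[OF carF(3)]
        by (simp add: close[OF i j])
    qed
    moreover have "separating ?D (G (k i j)) (d (k i j)) F C \<Phi>"
      unfolding separating_def
    proof (intro ballI impI)
      fix x assume x: "x \<in> F" "x \<noteq> \<one>\<^bsub>?D\<^esub>"
      have "max (d i (\<Theta> x) \<one>\<^bsub>G i\<^esub>) (d j (\<rho> (snd x)) \<one>\<^bsub>G j\<^esub>) > min c' (c / 2)"
      \<comment> \<open>On the kernel of the projection the wreath map separates; off it
        \<open>\<rho>\<close> does. Either lower bound passes to the maximum.\<close>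
      proof (cases "snd x = \<one>\<^bsub>\<Gamma>\<^esub>")
        case True
        then have x': "x = (fst x, \<one>\<^bsub>\<Gamma>\<^esub>)" "fst x \<noteq> \<one>\<^bsub>\<Delta>\<^esub>"
          using x(2) by (auto simp: semidirect_product_def prod_eq_iff)
        then have "d i (\<Theta> x) \<one>\<^bsub>G i\<^esub> > c / 2"
          using \<Theta>_sep[rule_format, of "fst x"] x(1) by simp
        then show ?thesis by linarith
      next
        case False
        then have "d j (\<rho> (snd x)) \<one>\<^bsub>G j\<^esub> > c'"
          using \<rho>(4) x(1) by (simp add: separating_def)
        then show ?thesis by linarith
      qed
      then have "C < \<mu> * max (d i (\<Theta> x) \<one>\<^bsub>G i\<^esub>) (d j (\<rho> (snd x)) \<one>\<^bsub>G j\<^esub>)"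
        using \<mu> by (simp add: C_def)
      \<comment> \<open>The lower bound is used against the pair of units, which the homomorphism
        \<open>D i j\<close> sends to the unit.\<close>
      also have "\<dots> \<le> d (k i j) (D i j (\<Theta> x, \<rho> (snd x))) (D i j (\<one>\<^bsub>G i\<^esub>, \<one>\<^bsub>G j\<^esub>))"
        using car[OF subsetD[OF F(2) x(1)]] by (intro lower[rule_format] i j) simp_all
      also have "\<dots> = d (k i j) (\<Phi> x) \<one>\<^bsub>G (k i j)\<^esub>"
        using D.hom_one by (simp add: \<Phi>_def)
      finally show "C < d (k i j) (\<Phi> x) \<one>\<^bsub>G (k i j)\<^esub>" .
    qed
    ultimately show "\<exists>i\<in>I. \<exists>\<phi>\<in>carrier ?D \<rightarrow> carrier (G i). unital ?D (G i) \<phi> \<and>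
        multiplicative ?D (G i) (d i) F \<epsilon> \<phi> \<and> separating ?D (G i) (d i) F C \<phi>"
      using k by blast
  qed
  moreover have "C > 0"
    using \<mu> c'(1) assms(6) by (simp add: C_def)
  ultimately show ?thesis
    using group_semidirect_product[OF \<Gamma> \<Delta> \<beta>]
    by (auto simp: approximable_groups_def approximable_def)
qed

end
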